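(* Suppose that the level set $\mathcal{X}=\{x\in\mathbb{R}^n:F(x)\le F(x^{(0)})\}$ is compact, and let $\{(x^{(t)},y^{(t)}):t\in\mathbb{N}\}$ be generated by MPGA with some sequence of chosen indices $\mathcal{I}_{\infty}=(i_{(0)},i_{(1)},i_{(2)},\dots)$. Then $\{Q_{(l(t))}:t\in\mathbb{N}\}$ is monotonically non-increasing, and there is some $Q_{\mathcal{I}_{\infty}}\in[0,F(x^{(0)})]$ such that $$\lim_{t\to\infty}Q_{(l(t))}=Q_{\mathcal{I}_{\infty}}.$$ Furthermore, $$\lim_{t\to\infty}\left(\|x^{(t+1)}-x^{(t)}\|_2^2+Q_{\mathcal{I}_{\infty}}\|y^{(t+1)}-y^{(t)}\|_2^2\right)=0.$$
   Context: Setting. $f,g,h:\mathbb{R}^n\to(-\infty,+\infty]$ are proper lower semicontinuous functions, $\Omega:=\{x\in\mathbb{R}^n: g(x)\neq 0\}$ is nonempty, and $f$ is block-separable: $f(x)=\sum_{i=1}^N f_i(x_i)$, where the subvectors $x_i\in\mathbb{R}^{n_i}$ form a partition of the components of $x$ and each $f_i:\mathbb{R}^{n_i}\to(-\infty,+\infty]$ is proper lower semicontinuous. Standing assumptions: (a) $f$ is continuous on $\mathrm{dom}(f)$ and each $f_i$ is bounded below; (b) $h$ is locally Lipschitz differentiable on $\Omega$, i.e. every $x\in\Omega$ has a neighborhood $\mathcal{B}(x)$ and a constant $L_x$ with $\|\nabla h(u)-\nabla h(v)\|_2\le L_x\|u-v\|_2$ for all $u,v\in\mathcal{B}(x)\cap\Omega$;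 (c) $g$ is convex, real-valued and nonnegative on $\mathbb{R}^n$; (d) $f+h\ge 0$ on $\mathrm{dom}(f)$. Notation. $\mathrm{dom}(\varphi)=\{x:\varphi(x)<+\infty\}$; $g^*(y)=\sup_x\{\langle x,y\rangle-g(x)\}$; $\partial g$ is the convex subdifferential; $\nabla_ih$ is the partial gradient with respect to $x_i$; $\zeta(x):=f(x)+h(x)$; $\eta(x,y):=\langle x,y\rangle-g^*(y)$. $F(x)=\zeta(x)/g(x)$ if $x\in\Omega\cap\mathrm{dom}(f)$ and $F(x)=+\infty$ otherwise. $Q(x,y)=\zeta(x)/\eta(x,y)$ if $(x,y)\in\mathrm{dom}(f)\times\mathrm{dom}(g^* )$ and $\eta(x,y)>0$, and $Q(x,y)=+\infty$ otherwise. $\mathrm{prox}_{\varphi}(x)=\arg\min_z\{\varphi(z)+\frac12\|z-x\|_2^2\}$ (possibly set-valued). $[s]_+=\max\{0,s\}$. Algorithm MPGA. Input: $x^{(0)}\in\mathrm{dom}(F)$, $y^{(0)}\in\partial g(x^{(0)})$, reals $0<\underline{\alpha}\le\overline{\alpha}$, $\sigma>0$, $0<\gamma<1$, an integer $M\ge0$. For $t=0,1,2,\dots$: Step 1. Let $Q_{(t)}=Q(x^{(t)},y^{(t)})$ and $l(t)=\max\{j\le t:Q_{(j)}=\max\{Q_{(s)}:[t-M]_+\le s\le t\}\}$. Step 2. Pick $i\in\{0,1,\dots,N\}$ and an initial $\alpha\in[\underline{\alpha},\overline{\alpha}]$. Step 2-Y (if $i=0$): set $x^{(t+1)}=x^{(t)}$,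 $y^{(t+1)}=\mathrm{prox}_{\alpha g^*}(y^{(t)}+\alpha x^{(t)})$. Step 2-X (if $i\ge1$): compute $x_i^{(t)}(\alpha)\in\mathrm{prox}_{\alpha f_i}\big(x_i^{(t)}-\alpha\nabla_ih(x^{(t)})+\alpha Q_{(t)}y_i^{(t)}\big)$ and let $x^{(t),i}(\alpha)$ be $x^{(t)}$ with its $i$-th block replaced by $x_i^{(t)}(\alpha)$. If $\zeta(x^{(t),i}(\alpha))+\frac{\sigma}{2}\|x^{(t),i}(\alpha)-x^{(t)}\|_2^2\le Q_{(l(t))}\,\eta(x^{(t),i}(\alpha),y^{(t)})$, set $(x^{(t+1)},y^{(t+1)})=(x^{(t),i}(\alpha),y^{(t)})$; otherwise replace $\alpha$ by $\alpha\gamma$ and repeat Step 2-X. Step 3. Record $i_{(t)}=i$ and $\alpha_{(t)}=\alpha$ (the final value of $\alpha$); go to the next $t$. *)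

theory Defs
  imports "HOL-Analysis.Analysis"
begin

definition edom :: "('a \<Rightarrow> ereal) \<Rightarrow> 'a set" where
  "edom \<phi> = {x. \<phi> x < \<infinity>}"

definition proper_on :: "'a set \<Rightarrow> ('a \<Rightarrow> ereal) \<Rightarrow> bool" where
  "proper_on S \<phi> \<longleftrightarrow> (\<forall>x\<in>S. \<phi> x \<noteq> -\<infinity>) \<and> (\<exists>x\<in>S. \<phi> x < \<infinity>)"

definition lsc_on :: "'a::topological_space set \<Rightarrow> ('a \<Rightarrow> ereal) \<Rightarrow> bool" where
  "lsc_on S \<phi> \<longleftrightarrow> (\<forall>x\<in>S. \<phi> x \<le> Liminf (at x within S) \<phi>)"

definition conjugate :: "('a::real_inner \<Rightarrow> real) \<Rightarrow> 'a \<Rightarrow> ereal" where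
  "conjugate g y = (SUP x. ereal (x \<bullet> y - g x))"

definition subdiff :: "('a::real_inner \<Rightarrow> real) \<Rightarrow> 'a \<Rightarrow> 'a set" where
  "subdiff g x = {y. \<forall>z. g x + y \<bullet> (z - x) \<le> g z}"

text \<open>The gradient at a point of an extended-real-valued function, which has to be finite near
  that point.\<close>

definition has_egrad :: "('a::real_inner \<Rightarrow> ereal) \<Rightarrow> 'a \<Rightarrow> 'a \<Rightarrow> bool" where
  "has_egrad \<phi> x D \<longleftrightarrow>
     (\<forall>\<^sub>F u in nhds x. \<bar>\<phi> u\<bar> \<noteq> \<infinity>) \<and> GDERIV (\<lambda>u. real_of_ereal (\<phi> u)) x :> D"

definition egrad :: "('a::real_inner \<Rightarrow> ereal) \<Rightarrow> 'a \<Rightarrow> 'a" where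
  "egrad \<phi> x = (THE D. has_egrad \<phi> x D)"

definition loc_lipschitz_differentiable_on :: "('a::real_inner \<Rightarrow> ereal) \<Rightarrow> 'a set \<Rightarrow> bool" where
  "loc_lipschitz_differentiable_on \<phi> S \<longleftrightarrow>
     (\<forall>x\<in>S. \<exists>D. has_egrad \<phi> x D) \<and>
     (\<forall>x\<in>S. \<exists>B L. open B \<and> x \<in> B \<and>
        (\<forall>u\<in>B \<inter> S. \<forall>v\<in>B \<inter> S. norm (egrad \<phi> u - egrad \<phi> v) \<le> L * norm (u - v)))"

text \<open>The carrier \<open>S\<close> is needed for the proximal operators of the blocks, see \<open>block_space\<close> below.\<close>

definition prox_on :: "'a::real_normed_vector set \<Rightarrow> ('a \<Rightarrow> ereal) \<Rightarrow> 'a \<Rightarrow> 'a set" where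
  "prox_on S \<phi> x =
     {z. is_arg_min (\<lambda>w. \<phi> w + ereal (1 / 2 * (norm (w - x))\<^sup>2)) (\<lambda>w. w \<in> S) z}"

text \<open>A map \<open>blk\<close> with range \<open>{1..N}\<close> assigns to every coordinate the number of its block. The
  space of the \<open>i\<close>-th subvectors is represented by the coordinate subspace
  \<open>block_space blk i\<close> (an isometric copy of it, of dimension \<open>card {j. blk j = i}\<close>), and
  \<open>block blk i x\<close> is the \<open>i\<close>-th subvector of \<open>x\<close>.\<close>

definition block_space :: "('n::finite \<Rightarrow> nat) \<Rightarrow> nat \<Rightarrow> (real^'n) set" where
  "block_space blk i = {z. \<forall>j. blk j \<noteq> i \<longrightarrow> z $ j = 0}"

definition block :: "('n::finite \<Rightarrow> nat) \<Rightarrow> nat \<Rightarrow> real^'n \<Rightarrow> real^'n" where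
  "block blk i x = (\<chi> j. if blk j = i then x $ j else 0)"

definition replace_block :: "('n::finite \<Rightarrow> nat) \<Rightarrow> nat \<Rightarrow> real^'n \<Rightarrow> real^'n \<Rightarrow> real^'n" where
  "replace_block blk i x z = (\<chi> j. if blk j = i then z $ j else x $ j)"

definition zeta :: "('a \<Rightarrow> ereal) \<Rightarrow> ('a \<Rightarrow> ereal) \<Rightarrow> 'a \<Rightarrow> ereal" where
  "zeta f h x = f x + h x"

definition eta :: "('a::real_inner \<Rightarrow> real) \<Rightarrow> 'a \<Rightarrow> 'a \<Rightarrow> ereal" where
  "eta g x y = ereal (x \<bullet> y) - conjugate g y"

definition F_obj :: "('a \<Rightarrow> ereal) \<Rightarrow> ('a \<Rightarrow> real) \<Rightarrow> ('a \<Rightarrow> ereal) \<Rightarrow> 'a \<Rightarrow> ereal" where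
  "F_obj f g h x = (if g x \<noteq> 0 \<and> x \<in> edom f then zeta f h x / ereal (g x) else \<infinity>)"

definition Q_obj ::
  "('a::real_inner \<Rightarrow> ereal) \<Rightarrow> ('a \<Rightarrow> real) \<Rightarrow> ('a \<Rightarrow> ereal) \<Rightarrow> 'a \<Rightarrow> 'a \<Rightarrow> ereal" where
  "Q_obj f g h x y =
     (if x \<in> edom f \<and> y \<in> edom (conjugate g) \<and> eta g x y > 0
      then zeta f h x / eta g x y else \<infinity>)"

text \<open>Truncated subtraction on the naturals renders the lower end \<open>[t - M]\<^sub>+\<close> of the window.\<close>

definition l_index :: "nat \<Rightarrow> (nat \<Rightarrow> ereal) \<Rightarrow> nat \<Rightarrow> nat" where
  "l_index M Qs t = Max {j. j \<le> t \<and> Qs j = Max (Qs ` {t - M..t})}"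

definition y_step ::
  "('a::real_inner \<Rightarrow> real) \<Rightarrow> real \<Rightarrow> 'a \<Rightarrow> 'a \<Rightarrow> 'a \<Rightarrow> bool" where
  "y_step g \<alpha> x y y' \<longleftrightarrow>
     y' \<in> prox_on UNIV (\<lambda>z. ereal \<alpha> * conjugate g z) (y + \<alpha> *\<^sub>R x)"

text \<open>The candidates for \<open>x\<^sup>(\<^sup>t\<^sup>)\<^sup>,\<^sup>i(\<alpha>)\<close>; there may be several, as the proximal operator of \<open>f\<^sub>i\<close> is
  set-valued. The parameter \<open>q\<close> is the value \<open>Q\<^sub>(\<^sub>t\<^sub>)\<close>.\<close>

definition x_trials ::
  "(nat \<Rightarrow> real^'n \<Rightarrow> ereal) \<Rightarrow> (real^'n \<Rightarrow> ereal) \<Rightarrow> ('n::finite \<Rightarrow> nat) \<Rightarrow> nat \<Rightarrow> real \<Rightarrow> real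
    \<Rightarrow> real^'n \<Rightarrow> real^'n \<Rightarrow> (real^'n) set" where
  "x_trials fi h blk i q \<alpha> x y =
     replace_block blk i x `
       prox_on (block_space blk i) (\<lambda>z. ereal \<alpha> * fi i z)
         (block blk i x - \<alpha> *\<^sub>R block blk i (egrad h x) + (\<alpha> * q) *\<^sub>R block blk i y)"

text \<open>The acceptance test of the line search, where \<open>r\<close> is the reference value \<open>Q\<^sub>(\<^sub>l\<^sub>(\<^sub>t\<^sub>)\<^sub>)\<close>.\<close>

definition accepted ::
  "('a::real_inner \<Rightarrow> ereal) \<Rightarrow> ('a \<Rightarrow> real) \<Rightarrow> ('a \<Rightarrow> ereal) \<Rightarrow> real \<Rightarrow> ereal \<Rightarrow> 'a \<Rightarrow> 'a \<Rightarrow> 'a \<Rightarrow> bool"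
  where
  "accepted f g h \<sigma> r x y u \<longleftrightarrow>
     zeta f h u + ereal (\<sigma> / 2 * (norm (u - x))\<^sup>2) \<le> r * eta g u y"

text \<open>A step with block \<open>i \<ge> 1\<close>: starting from some \<open>\<alpha>\<^sub>0\<close>, the backtracking line search
  rejects one trial point for each of the first \<open>k\<close> step sizes and then accepts \<open>x'\<close>, found
  with the step size \<open>\<alpha> = \<alpha>\<^sub>0 \<gamma>\<^sup>k\<close>. The coercion of \<open>q = Q\<^sub>(\<^sub>t\<^sub>)\<close> is harmless, as this value is finite along
  every run.\<close>

definition x_step ::
  "(real^'n \<Rightarrow> ereal) \<Rightarrow> (nat \<Rightarrow> real^'n \<Rightarrow> ereal) \<Rightarrow> (real^'n \<Rightarrow> real) \<Rightarrow> (real^'n \<Rightarrow> ereal)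
    \<Rightarrow> ('n::finite \<Rightarrow> nat) \<Rightarrow> real \<Rightarrow> real \<Rightarrow> real \<Rightarrow> real \<Rightarrow> ereal \<Rightarrow> nat \<Rightarrow> ereal \<Rightarrow> real
    \<Rightarrow> real^'n \<Rightarrow> real^'n \<Rightarrow> real^'n \<Rightarrow> bool" where
  "x_step f fi g h blk \<alpha>lo \<alpha>hi \<sigma> \<gamma> r i q \<alpha> x y x' \<longleftrightarrow>
     (\<exists>\<alpha>\<^sub>0\<in>{\<alpha>lo..\<alpha>hi}. \<exists>k::nat. \<alpha> = \<alpha>\<^sub>0 * \<gamma> ^ k \<and>
        (\<forall>j<k. \<exists>u\<in>x_trials fi h blk i (real_of_ereal q) (\<alpha>\<^sub>0 * \<gamma> ^ j) x y.
                 \<not> accepted f g h \<sigma> r x y u) \<and>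
        x' \<in> x_trials fi h blk i (real_of_ereal q) \<alpha> x y \<and>
        accepted f g h \<sigma> r x y x')"

text \<open>\<open>x\<close>, \<open>y\<close>, \<open>idx\<close> and \<open>\<alpha>\<close> are sequences of iterates, chosen indices and final step sizes
  of one run of the algorithm.\<close>

definition MPGA ::
  "(real^'n \<Rightarrow> ereal) \<Rightarrow> (nat \<Rightarrow> real^'n \<Rightarrow> ereal) \<Rightarrow> (real^'n \<Rightarrow> real) \<Rightarrow> (real^'n \<Rightarrow> ereal)
    \<Rightarrow> ('n::finite \<Rightarrow> nat) \<Rightarrow> nat \<Rightarrow> real \<Rightarrow> real \<Rightarrow> real \<Rightarrow> real \<Rightarrow> nat
    \<Rightarrow> (nat \<Rightarrow> real^'n) \<Rightarrow> (nat \<Rightarrow> real^'n) \<Rightarrow> (nat \<Rightarrow> nat) \<Rightarrow> (nat \<Rightarrow> real) \<Rightarrow> bool" where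
  "MPGA f fi g h blk N \<alpha>lo \<alpha>hi \<sigma> \<gamma> M x y idx \<alpha> \<longleftrightarrow>
     x 0 \<in> edom (F_obj f g h) \<and> y 0 \<in> subdiff g (x 0) \<and>
     (let Qs = (\<lambda>t. Q_obj f g h (x t) (y t)) in
      \<forall>t. idx t \<in> {0..N} \<and>
        (idx t = 0 \<longrightarrow>
           \<alpha> t \<in> {\<alpha>lo..\<alpha>hi} \<and> x (Suc t) = x t \<and> y_step g (\<alpha> t) (x t) (y t) (y (Suc t))) \<and>
        (idx t \<ge> 1 \<longrightarrow>
           x_step f fi g h blk \<alpha>lo \<alpha>hi \<sigma> \<gamma> (Qs (l_index M Qs t)) (idx t) (Qs t) (\<alpha> t)
             (x t) (y t) (x (Suc t)) \<and> y (Suc t) = y t))"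

end

theory Submission
  imports Defs
begin

text \<open>
  Let \<open>L\<close> be the limit of the reference values \<open>Q\<^sub>(\<^sub>l\<^sub>(\<^sub>t\<^sub>)\<^sub>)\<close>. Since \<open>\<eta>(x\<^sup>(\<^sup>t\<^sup>), y\<^sup>(\<^sup>t\<^sup>))\<close> might
  tend to \<open>0\<close>, where the quotient \<open>Q\<close> is badly behaved, the usual backward propagation along a
  nonmonotone line search is carried out for \<open>A\<^sub>t = L \<eta>(x\<^sup>(\<^sup>t\<^sup>), y\<^sup>(\<^sup>t\<^sup>)) - \<zeta>(x\<^sup>(\<^sup>t\<^sup>))\<close> instead of
  \<open>Q\<^sub>(\<^sub>t\<^sub>)\<close>. It is nonpositive at the indices \<open>l(t)\<close>, a small value of \<open>A\<^sub>t\<^sub>+\<^sub>1\<close> forces a short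
  step \<open>t\<close>, and a short step changes \<open>A\<close> little (steps in \<open>y\<close> only increase it). As every window
  of length \<open>M + 1\<close> contains some \<open>l(t)\<close>, at most \<open>M\<close> backward steps reach every index.
\<close>

section \<open>The conjugate, \<open>eta\<close> and the effect of a single step\<close>

lemma conjugate_not_MInf: "conjugate g y \<noteq> -\<infinity>"
proof -
  have "ereal (0 \<bullet> y - g 0) \<le> conjugate g y"
    unfolding conjugate_def by (rule SUP_upper) simp
  then show ?thesis by auto
qed

text \<open>The Fenchel-Young inequality. An infinite conjugate turns \<open>eta\<close> into
  -\<infinity>, so the bound holds for every \<open>y\<close>.\<close>

lemma eta_le: "eta g x y \<le> ereal (g x)"
proof -
  have "ereal (x \<bullet> y - g x) \<le> conjugate g y"
    unfolding conjugate_def by (rule SUP_upper) simp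
  then show ?thesis
    unfolding eta_def by (cases "conjugate g y") auto
qed

lemma conjugate_real:
  assumes "y \<in> edom (conjugate g)"
  shows "conjugate g y = ereal (real_of_ereal (conjugate g y))"
  using assms conjugate_not_MInf[of g y] unfolding edom_def
  by (cases "conjugate g y") auto

lemma eta_real:
  assumes "y \<in> edom (conjugate g)"
  shows "eta g x y = ereal (x \<bullet> y - real_of_ereal (conjugate g y))"
  unfolding eta_def by (subst conjugate_real[OF assms]) simp

text \<open>The equality case of Fenchel-Young. It makes the first value of \<open>Q_obj\<close>
  along a run equal to \<open>F_obj f g h (x 0)\<close>, the source of the upper bound on the
  limit.\<close>

lemma eta_subgradient:
  assumes "y \<in> subdiff g x"
  shows "y \<in> edom (conjugate g)" and "eta g x y = ereal (g x)"
proof -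
  have "conjugate g y \<le> ereal (x \<bullet> y - g x)"
    unfolding conjugate_def
  proof (rule SUP_least)
    fix z
    have "g x + y \<bullet> (z - x) \<le> g z"
      using assms unfolding subdiff_def by simp
    then show "ereal (z \<bullet> y - g z) \<le> ereal (x \<bullet> y - g x)"
      by (simp add: inner_diff_right inner_commute)
  qed
  then show "y \<in> edom (conjugate g)" and "eta g x y = ereal (g x)"
    using eta_le[of g x y] unfolding edom_def eta_def
    by (cases "conjugate g y"; force)+
qed

text \<open>The proximal objective at its minimizer \<open>y'\<close> is compared with its finite
  value at \<open>y\<close>. Expanding the square around \<open>y\<close> cancels the common term
  and leaves the increase of \<open>eta\<close>.\<close>

lemma eta_y_step:
  assumes y: "y \<in> edom (conjugate g)" and "0 < \<alpha>" and "y_step g \<alpha> x y y'"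
  shows "y' \<in> edom (conjugate g)"
    and "eta g x y + ereal ((norm (y' - y))\<^sup>2 / (2 * \<alpha>)) \<le> eta g x y'"
proof -
  define c where "c = real_of_ereal (conjugate g y)"
  have c: "conjugate g y = ereal c"
    unfolding c_def by (rule conjugate_real[OF y])
  have "ereal \<alpha> * conjugate g y' + ereal (1 / 2 * (norm (y' - (y + \<alpha> *\<^sub>R x)))\<^sup>2)
      \<le> ereal \<alpha> * conjugate g y + ereal (1 / 2 * (norm (y - (y + \<alpha> *\<^sub>R x)))\<^sup>2)"
    using assms(3) unfolding y_step_def prox_on_def is_arg_min_def not_less[symmetric] by blast
  then have le: "ereal \<alpha> * conjugate g y' + ereal (1 / 2 * (norm (y' - (y + \<alpha> *\<^sub>R x)))\<^sup>2)
      \<le> ereal (\<alpha> * c + 1 / 2 * (norm (y - (y + \<alpha> *\<^sub>R x)))\<^sup>2)"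
    by (simp only: c times_ereal.simps plus_ereal.simps)
  then show y': "y' \<in> edom (conjugate g)"
    using \<open>0 < \<alpha>\<close> unfolding edom_def by (cases "conjugate g y'") auto
  define c' where "c' = real_of_ereal (conjugate g y')"
  have c': "conjugate g y' = ereal c'"
    unfolding c'_def by (rule conjugate_real[OF y'])
  have "\<alpha> * c' + 1 / 2 * (norm (y' - (y + \<alpha> *\<^sub>R x)))\<^sup>2
      \<le> \<alpha> * c + 1 / 2 * (norm (y - (y + \<alpha> *\<^sub>R x)))\<^sup>2"
    using le c' by simp
  moreover have "(norm (y' - (y + \<alpha> *\<^sub>R x)))\<^sup>2
      = (norm (y' - y))\<^sup>2 - 2 * \<alpha> * (x \<bullet> y' - x \<bullet> y) + (norm (y - (y + \<alpha> *\<^sub>R x)))\<^sup>2"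
    unfolding power2_norm_eq_inner
    by (simp add: inner_diff_left inner_diff_right inner_add_left inner_add_right
        inner_commute algebra_simps)
  ultimately have "(norm (y' - y))\<^sup>2 \<le> 2 * \<alpha> * ((x \<bullet> y' - c') - (x \<bullet> y - c))"
    by (simp add: algebra_simps)
  then have "(norm (y' - y))\<^sup>2 / (2 * \<alpha>) \<le> (x \<bullet> y' - c') - (x \<bullet> y - c)"
    using \<open>0 < \<alpha>\<close> by (simp add: divide_le_eq mult.commute mult.left_commute)
  then show "eta g x y + ereal ((norm (y' - y))\<^sup>2 / (2 * \<alpha>)) \<le> eta g x y'"
    unfolding eta_def c c' by simp
qed

text \<open>The conjugate grows faster than \<open>R \<bar>y\<bar>\<close> by comparison with the point of norm \<open>R + 1\<close> in
  direction \<open>y\<close>.\<close>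

lemma eta_pos_imp_bounded:
  fixes y :: "'a::real_inner"
  assumes "0 < eta g x y" and "norm x \<le> R" and "0 \<le> R"
    and B: "\<And>z. norm z \<le> R + 1 \<Longrightarrow> g z \<le> B"
  shows "norm y \<le> B"
proof -
  define z where "z = (R + 1) *\<^sub>R sgn y"
  have "norm z \<le> R + 1"
    using \<open>0 \<le> R\<close> by (simp add: z_def norm_sgn)
  have "z \<bullet> y = (R + 1) * norm y"
    by (cases "y = 0") (simp_all add: z_def sgn_div_norm dot_square_norm power2_eq_square)
  have "ereal (z \<bullet> y - g z) \<le> conjugate g y"
    unfolding conjugate_def by (rule SUP_upper) simp
  then have "z \<bullet> y - g z < x \<bullet> y"
    using assms(1) unfolding eta_def by (cases "conjugate g y") auto
  moreover have "x \<bullet> y \<le> R * norm y"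
    using norm_cauchy_schwarz[of x y] mult_right_mono[OF \<open>norm x \<le> R\<close> norm_ge_zero[of y]]
    by linarith
  ultimately show ?thesis
    using B[OF \<open>norm z \<le> R + 1\<close>] \<open>z \<bullet> y = (R + 1) * norm y\<close>
    by (simp add: algebra_simps)
qed

text \<open>The right side of the test is finite, hence so is \<open>f u\<close>; then the left side
  is at least the quadratic term, because \<open>f + h\<close> is nonnegative on the domain. A
  nonpositive \<open>eta g u y\<close> would therefore force \<open>u = x\<close>, where
  \<open>eta\<close> is positive.\<close>

lemma accepted_finite_and_eta_pos:
  assumes f: "proper_on UNIV f" and h: "proper_on UNIV h"
    and nonneg: "\<And>v. v \<in> edom f \<Longrightarrow> 0 \<le> f v + h v"
    and y: "y \<in> edom (conjugate g)" and pos: "0 < eta g x y"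
    and "0 \<le> r" and "0 < \<sigma>"
    and acc: "accepted f g h \<sigma> (ereal r) x y u"
  shows "u \<in> edom f" and "0 < eta g u y"
proof -
  define e where "e = u \<bullet> y - real_of_ereal (conjugate g y)"
  have e: "eta g u y = ereal e"
    unfolding e_def by (rule eta_real[OF y])
  have le: "zeta f h u + ereal (\<sigma> / 2 * (norm (u - x))\<^sup>2) \<le> ereal (r * e)"
    using acc unfolding accepted_def e by simp
  have "f u \<noteq> -\<infinity>" "h u \<noteq> -\<infinity>"
    using f h unfolding proper_on_def by auto
  with le show u: "u \<in> edom f"
    unfolding zeta_def edom_def by (cases "f u"; cases "h u") auto
  have "0 \<le> zeta f h u"
    using nonneg[OF u] unfolding zeta_def .
  with le have *: "\<sigma> / 2 * (norm (u - x))\<^sup>2 \<le> r * e"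
    by (cases "zeta f h u") auto
  show "0 < eta g u y"
  proof (rule ccontr)
    assume "\<not> 0 < eta g u y"
    then have "e \<le> 0"
      unfolding e by simp
    then have "r * e \<le> 0"
      using \<open>0 \<le> r\<close> by (simp add: mult_nonneg_nonpos)
    with * have "\<sigma> / 2 * (norm (u - x))\<^sup>2 \<le> 0"
      by linarith
    then have "u = x"
      using \<open>0 < \<sigma>\<close> by (simp add: mult_le_0_iff)
    with pos \<open>\<not> 0 < eta g u y\<close> show False by simp
  qed
qed

section \<open>Reference indices and propagation backwards in time\<close>

lemma l_index_bounds:
  shows "t - M \<le> l_index M Qs t" and "l_index M Qs t \<le> t"
    and "Qs (l_index M Qs t) = Max (Qs ` {t - M..t})"
proof -
  define J where "J = {j. j \<le> t \<and> Qs j = Max (Qs ` {t - M..t})}"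
  have "Max (Qs ` {t - M..t}) \<in> Qs ` {t - M..t}"
    by (rule Max_in) auto
  then obtain j where j: "j \<in> {t - M..t}" "Qs j = Max (Qs ` {t - M..t})"
    by (metis imageE)
  have "finite J"
    unfolding J_def by simp
  have "j \<in> J"
    using j unfolding J_def by simp
  have "l_index M Qs t = Max J"
    unfolding l_index_def J_def ..
  moreover have "Max J \<in> J"
    using \<open>finite J\<close> \<open>j \<in> J\<close> by (intro Max_in) auto
  \<comment> \<open>\<open>J\<close> may contain indices from before the window; its largest element
    lies in the window because it is no smaller than the maximizer \<open>j\<close> found
    there.\<close>
  moreover have "j \<le> Max J"
    using \<open>finite J\<close> \<open>j \<in> J\<close> by (rule Max_ge)
  ultimately show "t - M \<le> l_index M Qs t" "l_index M Qs t \<le> t"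
    "Qs (l_index M Qs t) = Max (Qs ` {t - M..t})"
    using j unfolding J_def by auto
qed

lemma le_l_index:
  assumes "t - M \<le> s" and "s \<le> t"
  shows "Qs s \<le> Qs (l_index M Qs t)"
  unfolding l_index_bounds(3) using assms by (intro Max_ge) auto

text \<open>Either the new reference index is \<open>Suc t\<close>, which the assumption covers, or
  it already belongs to the window that ends at \<open>t\<close>.\<close>

lemma decseq_l_index:
  fixes Qs :: "nat \<Rightarrow> ereal"
  assumes "\<And>t. Qs (Suc t) \<le> Qs (l_index M Qs t)"
  shows "decseq (\<lambda>t. Qs (l_index M Qs t))"
proof (rule decseq_SucI)
  fix t
  let ?l = "l_index M Qs (Suc t)"
  show "Qs ?l \<le> Qs (l_index M Qs t)"
  proof (cases "?l = Suc t")
    case True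
    then show ?thesis using assms by simp
  next
    case False
    then show ?thesis
      using l_index_bounds(1,2)[where M=M and Qs=Qs and t="Suc t"] by (intro le_l_index) auto
  qed
qed

text \<open>\<open>R\<close> stands for the reference values and \<open>G\<close> for an upper bound
  on \<open>eta\<close>. It suffices that \<open>A\<close> is eventually below each positive number:
  then \<open>step\<close> and the convergence of \<open>R\<close> squeeze \<open>D\<close> to 0.
  These bounds come from \<open>window\<close>, carried back in time by \<open>step\<close> and
  \<open>modulus\<close>.\<close>

lemma backward_propagation:
  fixes A D R :: "nat \<Rightarrow> real"
  assumes R: "R \<longlonglongrightarrow> L" and "0 < c" and D: "\<And>s. 0 \<le> D s"
    and step: "\<And>s. c * D s \<le> A (Suc s) + (R s - L) * G"
    and modulus: "\<And>\<epsilon>. 0 < \<epsilon> \<Longrightarrow> \<exists>\<delta>>0. \<forall>s. D s < \<delta> \<longrightarrow> A s \<le> A (Suc s) + \<epsilon>"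
    and window: "\<And>t. \<exists>k\<le>M. A (t + k) \<le> 0"
  shows "D \<longlonglongrightarrow> 0"
proof -
  have gap: "(\<lambda>s. (R s - L) * G) \<longlonglongrightarrow> 0"
    using tendsto_mult_right[OF tendsto_diff[OF R tendsto_const[of L]], of G] by simp
  \<comment> \<open>Induction on the distance \<open>k\<close> to a nonpositive value of
    \<open>A\<close>; \<epsilon> stays arbitrary because the induction hypothesis is needed for a
    smaller bound.\<close>
  have small_back: "\<forall>\<^sub>F s in sequentially. A (s + k) \<le> 0 \<longrightarrow> A s \<le> \<epsilon>" if "0 < \<epsilon>" for k \<epsilon>
    using that
  proof (induction k arbitrary: \<epsilon>)
    case 0
    then show ?case by simp
  next
    case (Suc k)
    obtain \<delta> where \<delta>: "\<delta> > 0" "\<And>s. D s < \<delta> \<Longrightarrow> A s \<le> A (Suc s) + \<epsilon> / 2"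
      using modulus[of "\<epsilon> / 2"] Suc.prems by auto
    \<comment> \<open>The second term and the gap, each at most \<open>c * \<delta> / 2\<close>,
      will give \<open>D s < \<delta>\<close>; the first term leaves room for the
      \<open>\<epsilon> / 2\<close> lost through \<open>modulus\<close>.\<close>
    define \<rho> where "\<rho> = min (\<epsilon> / 2) (c * \<delta> / 2)"
    have "0 < \<rho>"
      using \<delta>(1) \<open>0 < c\<close> Suc.prems by (simp add: \<rho>_def)
    have "\<forall>\<^sub>F s in sequentially. A (Suc s + k) \<le> 0 \<longrightarrow> A (Suc s) \<le> \<rho>"
      using Suc.IH[OF \<open>0 < \<rho>\<close>] by (subst eventually_sequentially_Suc)
    moreover have "\<forall>\<^sub>F s in sequentially. (R s - L) * G < c * \<delta> / 2"
      using \<delta>(1) \<open>0 < c\<close> by (intro order_tendstoD(2)[OF gap]) simp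
    ultimately show ?case
    proof eventually_elim
      case (elim s)
      show ?case
      proof
        assume "A (s + Suc k) \<le> 0"
        then have "A (Suc s) \<le> \<rho>"
          using elim(1) by simp
        then have "c * D s < c * \<delta>"
          using step[of s] elim(2) unfolding \<rho>_def by linarith
        then have "D s < \<delta>"
          using \<open>0 < c\<close> by simp
        then show "A s \<le> \<epsilon>"
          using \<delta>(2) \<open>A (Suc s) \<le> \<rho>\<close> unfolding \<rho>_def by fastforce
      qed
    qed
  qed
  have small: "\<forall>\<^sub>F s in sequentially. A s \<le> \<epsilon>" if "0 < \<epsilon>" for \<epsilon>
  proof -
    \<comment> \<open>The \<open>k\<close> supplied by \<open>window\<close> depends on
      \<open>s\<close>, so the finitely many cases are made to hold from a common index on.\<close>
    have "\<forall>\<^sub>F s in sequentially. \<forall>k\<in>{..M}. A (s + k) \<le> 0 \<longrightarrow> A s \<le> \<epsilon>"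
      using small_back[OF that] by (subst eventually_ball_finite_distrib) auto
    then show ?thesis
      by eventually_elim (use window in blast)
  qed
  show ?thesis
  proof (rule order_tendstoI)
    fix a :: real
    assume "a < 0"
    then show "\<forall>\<^sub>F s in sequentially. a < D s"
      using D by (intro always_eventually) (use less_le_trans in blast)
  next
    fix a :: real
    assume "0 < a"
    then have "0 < c * a / 2"
      using \<open>0 < c\<close> by simp
    from small[OF this] have "\<forall>\<^sub>F s in sequentially. A (Suc s) \<le> c * a / 2"
      by (subst eventually_sequentially_Suc)
    moreover have "\<forall>\<^sub>F s in sequentially. (R s - L) * G < c * a / 2"
      using \<open>0 < c * a / 2\<close> by (rule order_tendstoD(2)[OF gap])
    ultimately show "\<forall>\<^sub>F s in sequentially. D s < a"
    proof eventually_elim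
      case (elim s)
      then have "c * D s < c * a"
        using step[of s] by linarith
      then show ?case
        using \<open>0 < c\<close> by simp
    qed
  qed
qed

theorem theorem4p8:
  fixes f h :: "real^'n \<Rightarrow> ereal" and g :: "real^'n \<Rightarrow> real"
    and fi :: "nat \<Rightarrow> real^'n \<Rightarrow> ereal" and blk :: "'n::finite \<Rightarrow> nat" and N M :: nat
    and \<alpha>lo \<alpha>hi \<sigma> \<gamma> :: real
    and x y :: "nat \<Rightarrow> real^'n" and idx :: "nat \<Rightarrow> nat" and \<alpha> :: "nat \<Rightarrow> real"
  assumes f_proper: "proper_on UNIV f" and f_lsc: "lsc_on UNIV f"
    and h_proper: "proper_on UNIV h" and h_lsc: "lsc_on UNIV h"
    and g_lsc: "lsc_on UNIV (\<lambda>u. ereal (g u))"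
    and Omega_nonempty: "{u. g u \<noteq> 0} \<noteq> {}"
    and blk: "range blk = {1..N}"
    and f_separable: "\<And>u. f u = (\<Sum>i=1..N. fi i (block blk i u))"
    and fi_proper: "\<And>i. i \<in> {1..N} \<Longrightarrow> proper_on (block_space blk i) (fi i)"
    and fi_lsc: "\<And>i. i \<in> {1..N} \<Longrightarrow> lsc_on (block_space blk i) (fi i)"
    and f_continuous: "continuous_on (edom f) f"
    and fi_bounded_below:
      "\<And>i. i \<in> {1..N} \<Longrightarrow> \<exists>c::real. \<forall>z\<in>block_space blk i. ereal c \<le> fi i z"
    and h_smooth: "loc_lipschitz_differentiable_on h {u. g u \<noteq> 0}"
    and g_convex: "convex_on UNIV g" and g_nonneg: "\<And>u. 0 \<le> g u"
    and zeta_nonneg: "\<And>u. u \<in> edom f \<Longrightarrow> 0 \<le> f u + h u"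
    and parameters: "0 < \<alpha>lo" "\<alpha>lo \<le> \<alpha>hi" "0 < \<sigma>" "0 < \<gamma>" "\<gamma> < 1"
    and run: "MPGA f fi g h blk N \<alpha>lo \<alpha>hi \<sigma> \<gamma> M x y idx \<alpha>"
    and level_compact: "compact {u. F_obj f g h u \<le> F_obj f g h (x 0)}"
  defines "Qs \<equiv> \<lambda>t. Q_obj f g h (x t) (y t)"
  shows "decseq (\<lambda>t. Qs (l_index M Qs t)) \<and>
    (\<exists>Qinf::real. 0 \<le> Qinf \<and> ereal Qinf \<le> F_obj f g h (x 0) \<and>
       (\<lambda>t. Qs (l_index M Qs t)) \<longlonglongrightarrow> ereal Qinf \<and>
       (\<lambda>t. (norm (x (Suc t) - x t))\<^sup>2 + Qinf * (norm (y (Suc t) - y t))\<^sup>2) \<longlonglongrightarrow> 0)"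

proof -

  \<comment> \<open>Real-valued versions of the objective functions\<close>
  define \<Omega> where "\<Omega> = {u. g u \<noteq> 0}"
  define X where "X = {u. F_obj f g h u \<le> F_obj f g h (x 0)}"
  \<comment> \<open>The facts \<open>zeta\<close> and \<open>eta\<close> below tell where
    \<open>z\<close> and \<open>e\<close> agree with the extended-real functions; elsewhere
    \<open>real_of_ereal\<close> may have turned an infinite value into 0.\<close>
  define z where "z u = real_of_ereal (zeta f h u)" for u
  define e where "e u v = u \<bullet> v - real_of_ereal (conjugate g v)" for u v
  define C where "C = edom (conjugate g)"
  have x0: "F_obj f g h (x 0) < \<infinity>" and y0: "y 0 \<in> subdiff g (x 0)"
    and idx_0: "\<And>t. idx t = 0 \<Longrightarrow> \<alpha> t \<in> {\<alpha>lo..\<alpha>hi} \<and> x (Suc t) = x t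
      \<and> y_step g (\<alpha> t) (x t) (y t) (y (Suc t))"
    and idx_pos: "\<And>t. idx t \<noteq> 0 \<Longrightarrow> y (Suc t) = y t
      \<and> accepted f g h \<sigma> (Qs (l_index M Qs t)) (x t) (y t) (x (Suc t))"
    using run unfolding MPGA_def Let_def Qs_def[symmetric] edom_def x_step_def
    by (auto simp: Suc_le_eq)

  have eta: "eta g u v = ereal (e u v)" if "v \<in> C" for u v
    using eta_real that unfolding e_def C_def .
  have e_le: "e u v \<le> g u" if "v \<in> C" for u v
    using eta_le[of g u v] unfolding eta[OF that] by simp
  have h_fin: "\<bar>h u\<bar> \<noteq> \<infinity>" and h_cont: "isCont (\<lambda>u. real_of_ereal (h u)) u" if "u \<in> \<Omega>" for u
  proof -
    obtain d where "has_egrad h u d"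
      using h_smooth \<open>u \<in> \<Omega>\<close> unfolding loc_lipschitz_differentiable_on_def \<Omega>_def by auto
    then show "\<bar>h u\<bar> \<noteq> \<infinity>" "isCont (\<lambda>u. real_of_ereal (h u)) u"
      unfolding has_egrad_def gderiv_def
      by (auto dest: eventually_nhds_x_imp_x has_derivative_continuous)
  qed
  have f_fin: "\<bar>f u\<bar> \<noteq> \<infinity>" if "u \<in> edom f" for u
    using f_proper that unfolding proper_on_def edom_def by auto
  have zeta: "zeta f h u = ereal (z u)" and z_nonneg: "0 \<le> z u"
    and z_eq: "z u = real_of_ereal (f u) + real_of_ereal (h u)"
    if "u \<in> edom f" "u \<in> \<Omega>" for u
    using f_fin[OF that(1)] h_fin[OF that(2)] zeta_nonneg[OF that(1)]
    unfolding z_def zeta_def by (cases "f u"; cases "h u"; simp)+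
  have X_sub: "u \<in> edom f" "u \<in> \<Omega>" if "u \<in> X" for u
    using that x0 unfolding X_def F_obj_def \<Omega>_def by (auto split: if_splits)

  \<comment> \<open>Invariant of the run: the iterates stay in the level set\<close>
  have "x 0 \<in> X"
    unfolding X_def by simp
  have "0 < g (x 0)"
    using X_sub(2)[OF \<open>x 0 \<in> X\<close>] g_nonneg[of "x 0"] unfolding \<Omega>_def by simp
  define inv where "inv t \<longleftrightarrow> x t \<in> X \<and> y t \<in> C \<and> 0 < e (x t) (y t)" for t
  define q where "q t = z (x t) / e (x t) (y t)" for t
  define l where "l t = l_index M Qs t" for t
  have l_le: "l t \<le> t" for t
    unfolding l_def by (rule l_index_bounds)

  have Q_eq: "Qs t = ereal (q t)" and q_nonneg: "0 \<le> q t" if "inv t" for t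
    using that zeta[of "x t"] X_sub[of "x t"] eta[of "y t" "x t"] z_nonneg[of "x t"]
    unfolding inv_def Qs_def Q_obj_def q_def C_def by (auto simp: zero_ereal_def)

  have "inv 0" and Q0: "Qs 0 = F_obj f g h (x 0)"
  proof -
    have "y 0 \<in> C" and e0: "e (x 0) (y 0) = g (x 0)"
      using eta_subgradient[OF y0] eta[of "y 0" "x 0"] unfolding C_def by auto
    then show "inv 0"
      unfolding inv_def using \<open>0 < g (x 0)\<close> \<open>x 0 \<in> X\<close> by simp
    then have "Qs 0 = ereal (z (x 0) / g (x 0))"
      using Q_eq[of 0] e0 unfolding q_def by simp
    then show "Qs 0 = F_obj f g h (x 0)"
      using \<open>0 < g (x 0)\<close> X_sub[OF \<open>x 0 \<in> X\<close>] zeta[of "x 0"] unfolding F_obj_def by simp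
  qed

  \<comment> \<open>By Fenchel-Young, \<open>F_obj\<close> at \<open>u\<close> is at most
    \<open>z u / e u v\<close>. As \<open>q 0\<close> is the initial value of \<open>F_obj\<close>,
    a quotient of at most \<open>q 0\<close> puts \<open>u\<close> into the level set.\<close>
  have in_X: "u \<in> X"
    if "u \<in> edom f" "v \<in> C" "0 < e u v" "z u \<le> q 0 * e u v" for u v
  proof -
    have "0 < g u"
      using e_le[OF that(2), of u] that(3) by linarith
    then have u: "u \<in> \<Omega>" unfolding \<Omega>_def by simp
    have "z u \<le> q 0 * g u"
      using that(4) mult_left_mono[OF e_le[OF that(2), of u] q_nonneg[OF \<open>inv 0\<close>]] by linarith
    then have "z u / g u \<le> q 0"
      using \<open>0 < g u\<close> by (simp add: divide_le_eq)
    moreover have "F_obj f g h u = ereal (z u / g u)"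
      using \<open>0 < g u\<close> that(1) zeta[OF that(1) u] unfolding F_obj_def by simp
    ultimately show ?thesis
      using Q0 Q_eq[OF \<open>inv 0\<close>] unfolding X_def by (metis ereal_less_eq(3) mem_Collect_eq)
  qed

  have Y_ineq: "e (x t) (y t) + (norm (y (Suc t) - y t))\<^sup>2 / (2 * \<alpha>hi) \<le> e (x t) (y (Suc t))"
    "y (Suc t) \<in> C"
    if "idx t = 0" "y t \<in> C" for t
  proof -
    note s = idx_0[OF that(1)]
    have \<alpha>: "0 < \<alpha> t" "\<alpha> t \<le> \<alpha>hi"
      using s parameters by auto
    show "y (Suc t) \<in> C"
      using eta_y_step(1)[OF _ \<alpha>(1)] s that(2) unfolding C_def by blast
    then have "e (x t) (y t) + (norm (y (Suc t) - y t))\<^sup>2 / (2 * \<alpha> t) \<le> e (x t) (y (Suc t))"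
      using eta_y_step(2)[OF _ \<alpha>(1)] s that(2) eta unfolding C_def by fastforce
    \<comment> \<open>The step size varies with \<open>t\<close>; its upper bound yields one
      constant for all steps.\<close>
    moreover have "(norm (y (Suc t) - y t))\<^sup>2 / (2 * \<alpha>hi) \<le> (norm (y (Suc t) - y t))\<^sup>2 / (2 * \<alpha> t)"
      using \<alpha> by (intro divide_left_mono) auto
    ultimately show "e (x t) (y t) + (norm (y (Suc t) - y t))\<^sup>2 / (2 * \<alpha>hi)
        \<le> e (x t) (y (Suc t))"
      by linarith
  qed

  \<comment> \<open>In a \<open>y\<close>-step the numerator of the quotient stays and the
    denominator grows, so it does not exceed \<open>q t\<close>, which lies in the window. In an
    \<open>x\<close>-step the acceptance test is divided by the positive value of
    \<open>e\<close>.\<close>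
  have step: "inv (Suc t) \<and> q (Suc t) \<le> q (l t)
      \<and> (idx t \<noteq> 0 \<longrightarrow> z (x (Suc t)) + \<sigma> / 2 * (norm (x (Suc t) - x t))\<^sup>2
           \<le> q (l t) * e (x (Suc t)) (y t))"
    if inv: "inv t" "inv (l t)" and q0: "q (l t) \<le> q 0" for t
  proof (cases "idx t = 0")
    case True
    have "Qs t \<le> Qs (l t)"
      unfolding l_def by (rule le_l_index) auto
    then have "q t \<le> q (l t)"
      using Q_eq inv by simp
    have y: "y t \<in> C" and X: "x t \<in> X"
      using inv unfolding inv_def by auto
    have Suc: "x (Suc t) = x t" "y (Suc t) \<in> C" "e (x t) (y t) \<le> e (x t) (y (Suc t))"
      using idx_0[OF True] Y_ineq[OF True y] parameters
      by (auto intro: order_trans[rotated])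
    then have "inv (Suc t)"
      using inv X unfolding inv_def by auto
    moreover have "q (Suc t) \<le> q t"
      using Suc inv z_nonneg[OF X_sub[OF X]] unfolding q_def inv_def
      by (auto intro!: divide_left_mono)
    ultimately show ?thesis
      using True \<open>q t \<le> q (l t)\<close> by simp
  next
    case False
    define u where "u = x (Suc t)"
    have y: "y (Suc t) = y t" "y t \<in> C" and "0 < e (x t) (y t)"
      using idx_pos[OF False] inv unfolding inv_def by auto
    have acc: "accepted f g h \<sigma> (ereal (q (l t))) (x t) (y t) u"
      using idx_pos[OF False] Q_eq[OF inv(2)] unfolding u_def l_def by simp
    have pos: "0 < eta g (x t) (y t)"
      using eta y(2) \<open>0 < e (x t) (y t)\<close> by (simp add: zero_ereal_def)
    have u: "u \<in> edom f" "0 < e u (y t)"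
      using accepted_finite_and_eta_pos[OF f_proper h_proper zeta_nonneg _ pos
          q_nonneg[OF inv(2)] parameters(3) acc] y(2) eta unfolding C_def
      by (auto simp: zero_ereal_def)
    have "0 < g u"
      using e_le[OF y(2), of u] u(2) by linarith
    then have "zeta f h u = ereal (z u)"
      using zeta u(1) unfolding \<Omega>_def by simp
    then have le: "z u + \<sigma> / 2 * (norm (u - x t))\<^sup>2 \<le> q (l t) * e u (y t)"
      using acc y(2) eta unfolding accepted_def by simp
    moreover have "0 \<le> \<sigma> / 2 * (norm (u - x t))\<^sup>2"
      using parameters by simp
    ultimately have zle: "z u \<le> q (l t) * e u (y t)"
      by linarith
    have "z u \<le> q 0 * e u (y t)"
      using zle mult_right_mono[OF q0, of "e u (y t)"] u(2) by linarith
    from in_X[OF u(1) y(2) u(2) this] have "inv (Suc t)"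
      unfolding inv_def y(1) u_def[symmetric] using y(2) u(2) by simp
    moreover have "q (Suc t) \<le> q (l t)"
      using zle u(2) unfolding q_def y(1) u_def[symmetric] by (simp add: divide_le_eq)
    ultimately show ?thesis
      using le unfolding u_def by blast
  qed

  \<comment> \<open>All \<open>s \<le> t\<close> are covered at once, since \<open>step\<close> also
    needs the invariant at the earlier index \<open>l t\<close>.\<close>
  have all: "\<forall>s\<le>t. inv s \<and> q s \<le> q 0" for t
  proof (induction t)
    case 0
    then show ?case using \<open>inv 0\<close> by simp
  next
    case (Suc t)
    have "inv t" "inv (l t)" "q (l t) \<le> q 0"
      using Suc l_le[of t] by auto
    from step[OF this] this Suc show ?case
      by (auto simp: le_Suc_eq)
  qed
  have inv: "inv t" and q_le_0: "q t \<le> q 0" for t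
    using all by auto
  have q_nonneg: "0 \<le> q t" and Q_eq: "Qs t = ereal (q t)" for t
    using inv q_nonneg Q_eq by auto
  have q_Suc: "q (Suc t) \<le> q (l t)"
    and X_ineq: "idx t \<noteq> 0 \<Longrightarrow> z (x (Suc t)) + \<sigma> / 2 * (norm (x (Suc t) - x t))\<^sup>2
           \<le> q (l t) * e (x (Suc t)) (y t)" for t
    using step[OF inv inv q_le_0] by auto
  have xX: "x t \<in> X" and yC: "y t \<in> C" and e_pos: "0 < e (x t) (y t)" for t
    using inv[of t] unfolding inv_def by auto
  have z_q: "z (x t) = q t * e (x t) (y t)" for t
    using e_pos[of t] unfolding q_def by simp

  \<comment> \<open>The limit of the reference values\<close>
  have Ql: "Qs (l_index M Qs t) = ereal (q (l t))" for t
    unfolding l_def by (rule Q_eq)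
  have dec: "decseq (\<lambda>t. Qs (l_index M Qs t))"
  proof (rule decseq_l_index)
    show "Qs (Suc t) \<le> Qs (l_index M Qs t)" for t
      using q_Suc[of t] unfolding Ql Q_eq[of "Suc t"] by simp
  qed
  then have "decseq (\<lambda>t. q (l t))"
    unfolding Ql decseq_def by simp
  then obtain L where L: "(\<lambda>t. q (l t)) \<longlonglongrightarrow> L" and L_le: "\<And>t. L \<le> q (l t)"
    using decseq_convergent[of "\<lambda>t. q (l t)" 0] q_nonneg by blast
  have "0 \<le> L"
    using LIMSEQ_le_const[OF L] q_nonneg by blast
  have "L \<le> q 0"
    using L_le[of 0] l_le[of 0] by simp

  \<comment> \<open>Compactness: bounds on the iterates and uniform continuity of
    \<open>z\<close>\<close>
  have g_cont: "continuous_on S g" for S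
    using convex_on_continuous[OF open_UNIV g_convex] continuous_on_subset by blast
  have "compact X"
    using level_compact unfolding X_def .
  obtain r where r: "0 \<le> r" "\<And>u. u \<in> X \<Longrightarrow> norm u \<le> r"
    using compact_imp_bounded[OF \<open>compact X\<close>] unfolding bounded_pos
    by (auto intro: less_imp_le)
  \<comment> \<open>The radius \<open>r + 1\<close> is the one that
    \<open>eta_pos_imp_bounded\<close> asks for; the same \<open>G\<close> then bounds both
    \<open>e (x t) (y t)\<close> and the norm of \<open>y t\<close>.\<close>
  have "bounded (g ` cball 0 (r + 1))"
    by (intro compact_imp_bounded compact_continuous_image g_cont compact_cball)
  then obtain G where G: "\<And>u. norm u \<le> r + 1 \<Longrightarrow> g u \<le> G"
    unfolding bounded_pos by (fastforce simp: abs_le_iff)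
  have "e (x t) (y t) \<le> G" for t
    using e_le[OF yC, of "x t" t] G[of "x t"] r(2)[OF xX, of t] by linarith
  have y_bdd: "norm (y t) \<le> G" for t
  proof (rule eta_pos_imp_bounded[OF _ r(2)[OF xX] r(1) G])
    show "0 < eta g (x t) (y t)"
      using eta[OF yC] e_pos by (simp add: zero_ereal_def)
  qed

  have "continuous_on X z"
  proof -
    have "continuous_on X f"
      using continuous_on_subset[OF f_continuous] X_sub(1) by blast
    then have "continuous_on X (real_of_ereal \<circ> f)"
      by (subst (asm) continuous_on_iff_real) (use f_fin X_sub(1) in auto)
    moreover have "continuous_on X (\<lambda>u. real_of_ereal (h u))"
      using h_cont X_sub(2) by (simp add: continuous_at_imp_continuous_on)
    ultimately have "continuous_on X (\<lambda>u. real_of_ereal (f u) + real_of_ereal (h u))"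
      unfolding comp_def by (rule continuous_on_add)
    then show ?thesis
      using X_sub z_eq by (simp cong: continuous_on_cong)
  qed
  then have z_uc: "uniformly_continuous_on X z"
    using \<open>compact X\<close> by (rule compact_uniformly_continuous)

  \<comment> \<open>Vanishing of the steps\<close>
  define A where "A t = L * e (x t) (y t) - z (x t)" for t
  define D where "D t = (norm (x (Suc t) - x t))\<^sup>2 + L * (norm (y (Suc t) - y t))\<^sup>2" for t
  \<comment> \<open>The smaller of the two rates: \<sigma>/2 for steps in \<open>x\<close>,
    \<open>1 / (2 * \<alpha>hi)\<close> for steps in \<open>y\<close>.\<close>
  define c where "c = min (\<sigma> / 2) (1 / (2 * \<alpha>hi))"
  have "0 < \<alpha>hi"
    using parameters by simp
  have "0 < c" "c \<le> \<sigma> / 2" "c \<le> 1 / (2 * \<alpha>hi)"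
    unfolding c_def using parameters \<open>0 < \<alpha>hi\<close> by auto
  have "D \<longlonglongrightarrow> 0"
  proof (rule backward_propagation[OF L \<open>0 < c\<close>, where A=A and G=G and M=M])
    show "0 \<le> D t" for t
      unfolding D_def using \<open>0 \<le> L\<close> by simp
    show "c * D t \<le> A (Suc t) + (q (l t) - L) * G" for t
    proof (cases "idx t = 0")
      case True
      have x: "x (Suc t) = x t"
        using idx_0[OF True] by simp
      have "L * (e (x t) (y t) + (norm (y (Suc t) - y t))\<^sup>2 / (2 * \<alpha>hi))
          \<le> L * e (x t) (y (Suc t))"
        by (rule mult_left_mono[OF Y_ineq(1)[OF True yC] \<open>0 \<le> L\<close>])
      then have "A t + 1 / (2 * \<alpha>hi) * D t \<le> A (Suc t)"
        unfolding A_def D_def x by (simp add: algebra_simps)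
      moreover have "c * D t \<le> 1 / (2 * \<alpha>hi) * D t"
        using \<open>c \<le> 1 / (2 * \<alpha>hi)\<close> \<open>0 \<le> D t\<close> by (rule mult_right_mono)
      \<comment> \<open>The estimate so far bounds \<open>D t\<close> by
        \<open>A (Suc t) - A t\<close>. Here \<open>- A t\<close> equals
        \<open>(q t - L) * e (x t) (y t)\<close>, and \<open>q t\<close> is at most
        \<open>q (l t)\<close>.\<close>
      moreover have "- A t \<le> (q (l t) - L) * G"
      proof -
        have "Qs t \<le> Qs (l t)"
          unfolding l_def by (rule le_l_index) auto
        then have "(q t - L) * e (x t) (y t) \<le> (q (l t) - L) * e (x t) (y t)"
          using Q_eq e_pos[of t] by (intro mult_right_mono) auto
        also have "\<dots> \<le> (q (l t) - L) * G"
          using L_le[of t] \<open>e (x t) (y t) \<le> G\<close> by (intro mult_left_mono) auto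
        finally show ?thesis
          unfolding A_def z_q[of t] by (simp add: algebra_simps)
      qed
      ultimately show ?thesis by linarith
    next
      case False
      have y: "y (Suc t) = y t"
        using idx_pos[OF False] by simp
      have "c * D t \<le> \<sigma> / 2 * D t"
        using \<open>c \<le> \<sigma> / 2\<close> \<open>0 \<le> D t\<close> by (rule mult_right_mono)
      \<comment> \<open>The acceptance test with \<open>q (l t)\<close> split into \<open>L\<close>
        and the nonnegative gap \<open>q (l t) - L\<close>.\<close>
      also have "\<dots> \<le> A (Suc t) + (q (l t) - L) * e (x (Suc t)) (y (Suc t))"
        using X_ineq[OF False] unfolding A_def D_def y by (simp add: algebra_simps)
      also have "\<dots> \<le> A (Suc t) + (q (l t) - L) * G"
        using L_le[of t] \<open>e (x (Suc t)) (y (Suc t)) \<le> G\<close>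
        by (intro add_left_mono mult_left_mono) auto
      finally show ?thesis .
    qed
    show "\<exists>\<delta>>0. \<forall>t. D t < \<delta> \<longrightarrow> A t \<le> A (Suc t) + \<epsilon>" if "0 < \<epsilon>" for \<epsilon>
    proof -
      obtain d where d: "0 < d"
        "\<And>u v. u \<in> X \<Longrightarrow> v \<in> X \<Longrightarrow> norm (v - u) < d \<Longrightarrow> \<bar>z v - z u\<bar> < \<epsilon> / 2"
        using z_uc \<open>0 < \<epsilon>\<close> unfolding uniformly_continuous_on_def dist_norm real_norm_def
        by (metis half_gt_zero)
      have "0 \<le> G"
        using y_bdd[of 0] norm_ge_zero order_trans by blast
      \<comment> \<open>\<open>d\<close> controls the change of \<open>z\<close>, the other term
        that of \<open>L * e\<close>; adding 1 keeps the denominator positive when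
        \<open>L * G = 0\<close>. Since \<open>D\<close> consists of squared norms, the threshold
        will be the square of \<rho>.\<close>
      define \<rho> where "\<rho> = min d (\<epsilon> / (2 * (L * G + 1)))"
      have "0 < L * G + 1"
        using \<open>0 \<le> L\<close> \<open>0 \<le> G\<close> by (simp add: add_nonneg_pos)
      then have "0 < \<rho>"
        unfolding \<rho>_def using d(1) \<open>0 < \<epsilon>\<close> by simp
      have "A t \<le> A (Suc t) + \<epsilon>" if "D t < \<rho>\<^sup>2" for t
      proof (cases "idx t = 0")
        case True
        have "0 \<le> (norm (y (Suc t) - y t))\<^sup>2 / (2 * \<alpha>hi)"
          using \<open>0 < \<alpha>hi\<close> by simp
        then have "e (x t) (y t) \<le> e (x t) (y (Suc t))"
          using Y_ineq(1)[OF True yC] by linarith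
        then have "L * e (x t) (y t) \<le> L * e (x t) (y (Suc t))"
          using \<open>0 \<le> L\<close> by (rule mult_left_mono)
        then show ?thesis
          using idx_0[OF True] \<open>0 < \<epsilon>\<close> unfolding A_def by simp
      next
        case False
        have y: "y (Suc t) = y t"
          using idx_pos[OF False] by simp
        have "(norm (x (Suc t) - x t))\<^sup>2 < \<rho>\<^sup>2"
          using that unfolding D_def y by simp
        then have short: "norm (x (Suc t) - x t) < \<rho>"
          using \<open>0 < \<rho>\<close> by (simp add: power2_less_imp_less)
        then have "\<bar>z (x (Suc t)) - z (x t)\<bar> < \<epsilon> / 2"
          using d(2)[OF xX xX] unfolding \<rho>_def by simp
        moreover have "L * (e (x t) (y t) - e (x (Suc t)) (y t)) \<le> \<epsilon> / 2"
        proof -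
          have "e (x t) (y t) - e (x (Suc t)) (y t) = (x t - x (Suc t)) \<bullet> y t"
            unfolding e_def by (simp add: inner_diff_left)
          also have "\<dots> \<le> norm (x t - x (Suc t)) * norm (y t)"
            by (rule norm_cauchy_schwarz)
          also have "\<dots> \<le> \<rho> * G"
            using short y_bdd[of t] \<open>0 < \<rho>\<close> by (intro mult_mono) (auto simp: norm_minus_commute)
          finally have "L * (e (x t) (y t) - e (x (Suc t)) (y t)) \<le> L * (\<rho> * G)"
            using \<open>0 \<le> L\<close> by (rule mult_left_mono)
          also have "\<dots> \<le> \<rho> * (L * G + 1)"
            using \<open>0 < \<rho>\<close> by (simp add: algebra_simps)
          also have "\<dots> \<le> \<epsilon> / (2 * (L * G + 1)) * (L * G + 1)"
            using \<open>0 < L * G + 1\<close> unfolding \<rho>_def by (intro mult_right_mono) auto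
          also have "\<dots> = \<epsilon> / 2"
            using \<open>0 < L * G + 1\<close> by (simp add: field_simps)
          finally show ?thesis .
        qed
        ultimately show ?thesis
          unfolding A_def y right_diff_distrib by linarith
      qed
      then show ?thesis
        using \<open>0 < \<rho>\<close> by (intro exI[of _ "\<rho>\<^sup>2"]) simp
    qed
    show "\<exists>k\<le>M. A (t + k) \<le> 0" for t
    proof (intro exI conjI)
      \<comment> \<open>The window that ends at \<open>t + M\<close> starts at \<open>t\<close>, so
        the reference index is at most \<open>M\<close> steps ahead of \<open>t\<close>; there
        \<open>q\<close> is at least the limit \<open>L\<close>.\<close>
      let ?l = "l (t + M)"
      have l: "t \<le> ?l" "?l \<le> t + M"
        using l_index_bounds(1,2)[where M=M and Qs=Qs and t="t + M"] unfolding l_def by auto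
      then show "?l - t \<le> M" by simp
      have "L * e (x ?l) (y ?l) \<le> q ?l * e (x ?l) (y ?l)"
        using L_le e_pos[of ?l] by (intro mult_right_mono) auto
      then show "A (t + (?l - t)) \<le> 0"
        using l z_q[of ?l] unfolding A_def by simp
    qed
  qed
  then have "0 \<le> L \<and> ereal L \<le> F_obj f g h (x 0)
      \<and> (\<lambda>t. Qs (l_index M Qs t)) \<longlonglongrightarrow> ereal L
      \<and> (\<lambda>t. (norm (x (Suc t) - x t))\<^sup>2 + L * (norm (y (Suc t) - y t))\<^sup>2) \<longlonglongrightarrow> 0"
    using \<open>0 \<le> L\<close> \<open>L \<le> q 0\<close> Q0 Q_eq[of 0] L unfolding Ql D_def
    by (auto simp flip: Q0)
  with dec show ?thesis by blast
qed

end
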